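(* Let $0<k_1<k_2$ and let $u^{\pm}$ be the two-soliton solutions of the modified Korteweg--de Vries equation defined in the context, viewed as meromorphic functions of $x\in\mathbb{C}$ for each $t\in\mathbb{R}$. For either choice of sign, there exist $\alpha\in\mathbb{R}$, $t_0\in\mathbb{R}$ and $\delta>0$ such that the function $u(x,t)=u^{\pm}(x-i\alpha,t)$ has the following properties: for all $t$ with $0<|t-t_0|<\delta$, $u(\cdot,t)$ has no poles on $\mathbb{R}$, and $u$ is a smooth complex-valued solution of $$u_t+u_{xxx}+6u^2u_x=0,\qquad x\in\mathbb{R},\ 0<|t-t_0|<\delta,$$ which decays exponentially to zero as $x\to\pm\infty$ for each such $t$; but $u$ is singular at $t=t_0$, that is, $x\mapsto u^{\pm}(x-i\alpha,t_0)$ has a pole at some $x\in\mathbb{R}$. In particular, there are smooth complex-valued solutions of this equation on $\mathbb{R}$, exponentially decreasing to zero as $|x|\to\infty$, that blow up in finite time.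
   Context: For $0<k_1<k_2$ put $\gamma=\frac{k_2+k_1}{k_2-k_1}$ and $f_j(x,t)=\exp(-k_jx+k_j^3t)$ for $j=1,2$, $x\in\mathbb{C}$, $t\in\mathbb{R}$. Define $$u^{\pm}=2\gamma\frac{G^{\pm}}{F^{\pm}},\qquad G^{\pm}=\pm k_1f_1(1+f_2^2)+k_2f_2(1+f_1^2),\qquad F^{\pm}=(1\mp f_1f_2)^2+\gamma^2(f_1\pm f_2)^2 .$$ *)

theory Defs
  imports "HOL-Complex_Analysis.Complex_Analysis"
begin

definition soliton_exp :: "real \<Rightarrow> complex \<Rightarrow> real \<Rightarrow> complex" where
  "soliton_exp k x t = exp (- of_real k * x + of_real (k ^ 3 * t))"

definition soliton_gamma :: "real \<Rightarrow> real \<Rightarrow> real" where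
  "soliton_gamma k1 k2 = (k2 + k1) / (k2 - k1)"

text \<open>In the following three definitions the parameter \<open>s\<close> is the sign: \<open>s = 1\<close> gives
  \<open>G\<^sup>+, F\<^sup>+, u\<^sup>+\<close> and \<open>s = -1\<close> gives \<open>G\<^sup>-, F\<^sup>-, u\<^sup>-\<close>.\<close>

definition soliton_G :: "real \<Rightarrow> real \<Rightarrow> real \<Rightarrow> complex \<Rightarrow> real \<Rightarrow> complex" where
  "soliton_G s k1 k2 x t =
     (let f1 = soliton_exp k1 x t; f2 = soliton_exp k2 x t
      in of_real s * of_real k1 * f1 * (1 + f2 ^ 2) + of_real k2 * f2 * (1 + f1 ^ 2))"

definition soliton_F :: "real \<Rightarrow> real \<Rightarrow> real \<Rightarrow> complex \<Rightarrow> real \<Rightarrow> complex" where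
  "soliton_F s k1 k2 x t =
     (let f1 = soliton_exp k1 x t; f2 = soliton_exp k2 x t
      in (1 - of_real s * f1 * f2) ^ 2
         + of_real ((soliton_gamma k1 k2)\<^sup>2) * (f1 + of_real s * f2) ^ 2)"

text \<open>Common zeros of \<open>G\<close> and \<open>F\<close> do occur for some parameters (at \<open>t = 0\<close>), so the quotient
  is turned into a meromorphic function of \<open>x\<close> by filling in removable singularities.
  At genuine poles \<^const>\<open>remove_sings\<close> has the junk value 0.\<close>

definition two_soliton :: "real \<Rightarrow> real \<Rightarrow> real \<Rightarrow> complex \<Rightarrow> real \<Rightarrow> complex" where
  "two_soliton s k1 k2 x t =
     remove_sings
       (\<lambda>z. 2 * of_real (soliton_gamma k1 k2) * (soliton_G s k1 k2 z t / soliton_F s k1 k2 z t)) x"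

text \<open>\<open>C\<^sup>n\<close> and \<open>C\<^sup>\<infinity>\<close> functions on an open set.\<close>

fun Cn_on :: "nat \<Rightarrow> ('a::real_normed_vector \<Rightarrow> 'b::real_normed_vector) \<Rightarrow> 'a set \<Rightarrow> bool" where
  "Cn_on 0 f S \<longleftrightarrow> continuous_on S f"
| "Cn_on (Suc n) f S \<longleftrightarrow>
     (\<forall>x\<in>S. f differentiable (at x)) \<and> (\<forall>v. Cn_on n (\<lambda>x. frechet_derivative f (at x) v) S)"

definition smooth_on :: "('a::real_normed_vector \<Rightarrow> 'b::real_normed_vector) \<Rightarrow> 'a set \<Rightarrow> bool" where
  "smooth_on f S \<longleftrightarrow> (\<forall>n. Cn_on n f S)"

definition D_x :: "(real \<Rightarrow> real \<Rightarrow> complex) \<Rightarrow> real \<Rightarrow> real \<Rightarrow> complex" where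
  "D_x u x t = vector_derivative (\<lambda>y. u y t) (at x)"

definition D_t :: "(real \<Rightarrow> real \<Rightarrow> complex) \<Rightarrow> real \<Rightarrow> real \<Rightarrow> complex" where
  "D_t u x t = vector_derivative (\<lambda>\<tau>. u x \<tau>) (at t)"

text \<open>Smooth complex-valued solutions on \<open>\<real> \<times> T\<close>, where \<open>T\<close> is an open set of times;
  smoothness is joint in \<open>(x, t)\<close>.\<close>

definition smooth_mKdV_solution :: "(real \<Rightarrow> real \<Rightarrow> complex) \<Rightarrow> real set \<Rightarrow> bool" where
  "smooth_mKdV_solution u T \<longleftrightarrow>
     smooth_on (\<lambda>(x, t). u x t) (UNIV \<times> T) \<and>
     (\<forall>x. \<forall>t\<in>T. D_t u x t + (D_x ^^ 3) u x t + 6 * (u x t)\<^sup>2 * D_x u x t = 0)"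

definition exp_decay :: "(real \<Rightarrow> complex) \<Rightarrow> bool" where
  "exp_decay f \<longleftrightarrow>
     (\<exists>C c. c > 0 \<and> (\<forall>\<^sub>F x in at_infinity. norm (f x) \<le> C * exp (- c * \<bar>x\<bar>)))"

text \<open>Blow-up as \<open>t\<close> increases to \<open>T\<close>: the supremum norm of \<open>u(\<cdot>, t)\<close> tends to infinity.\<close>

definition blows_up_at :: "(real \<Rightarrow> real \<Rightarrow> complex) \<Rightarrow> real \<Rightarrow> bool" where
  "blows_up_at u T \<longleftrightarrow> (\<forall>M. \<forall>\<^sub>F t in at_left T. \<exists>x. norm (u x t) > M)"

end

theory Submission
  imports Defs
begin

text \<open>
  The function \<open>F\<close> splits as \<open>F = P Q\<close> with \<open>P, Q = 1 - s f\<^sub>1 f\<^sub>2 \<plusminus> \<i> \<gamma> (f\<^sub>1 + s f\<^sub>2)\<close>, and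
  \<open>u = \<i> s (P\<^sub>x / P - Q\<^sub>x / Q)\<close>. The equation for \<open>u\<close> follows from Hirota's bilinear
  equations for the pair \<open>P, Q\<close> (\<open>hirota_bilinear\<close>, \<open>mKdV_quotient\<close>), wherever \<open>F\<close> does not vanish.
  Since \<open>u\<close> is a rational function of exponentials, it is smooth there. It decays like
  \<open>f\<^sub>1\<close> at the right end of the line, and equally fast at the left end because it is invariant under
  \<open>f\<^sub>j \<mapsto> 1 / f\<^sub>j\<close> (\<open>profile_inverse\<close>).

  It remains to find a horizontal line \<open>Im z = - \<alpha>\<close> on which \<open>F\<close> vanishes at isolated
  times only, but at least once. On such a line \<open>f\<^sub>j = r\<^sub>j exp (\<i> k\<^sub>j \<alpha>)\<close> with amplitudes
  \<open>r\<^sub>j > 0\<close>, and \<open>(x, t) \<mapsto> (r\<^sub>1, r\<^sub>2)\<close> is a bijection of the plane onto the open quadrant. So for a fixed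
  \<open>\<alpha>\<close> the complex equation \<open>P = 0\<close> amounts to two real equations for two positive unknowns. Eliminating
  \<open>r\<^sub>2\<close> leaves a reciprocal quadratic equation for \<open>r\<^sub>1\<close> (\<open>tau_eliminant\<close>), so that the
  zeros on the line, and with them the singular times, are finite in number as soon as
  \<open>cos (k\<^sub>1 \<alpha>)\<close> and \<open>cos (k\<^sub>2 \<alpha>)\<close> are nonzero (\<open>finite_singular_times\<close>). If \<open>k\<^sub>2 \<alpha>\<close> lies slightly above \<open>s \<pi> / 2\<close>, then the
  quadratic equation has a positive root that leads to a positive \<open>r\<^sub>2\<close>
  (\<open>exists_admissible_line\<close>, \<open>tau_zero_exists\<close>).

  Finally \<open>G \<noteq> 0\<close> at such a zero: \<open>F\<close> and \<open>G\<close> vanish together only where \<open>f\<^sub>1 = \<plusminus>\<i>\<close>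
  (\<open>double_zero_imp_imaginary\<close>), and this is excluded by \<open>cos (k\<^sub>1 \<alpha>) > 0\<close>. Hence the zero of
  \<open>F\<close> is a genuine pole of \<open>u\<close>, and \<open>\<bar>u\<bar>\<close> tends to infinity at a fixed point of the line as
  \<open>t\<close> approaches the singular time.
\<close>

section \<open>Smoothness of rational functions of exponentials\<close>

text \<open>Coinduction for smoothness: a class of functions that is closed under directional
  derivatives consists of smooth functions. The detour through \<open>g\<close> makes the induction work: the Frechet derivative of \<open>f\<close>
  agrees with a member of the class on \<open>S\<close>, while its values off \<open>S\<close> are arbitrary.\<close>

lemma Cn_on_coinduct:
  assumes S: "open S"
    and step: "\<And>f. f \<in> C \<Longrightarrow> \<exists>D. (\<forall>x\<in>S. (f has_derivative D x) (at x)) \<and> (\<forall>v. (\<lambda>x. D x v) \<in> C)"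
    and "g \<in> C" and "\<And>x. x \<in> S \<Longrightarrow> f x = g x"
  shows "Cn_on n f S"
  using assms(3,4)
proof (induction n arbitrary: f g)
  case (0 f g)
  obtain D where "\<And>x. x \<in> S \<Longrightarrow> (g has_derivative D x) (at x)"
    using step[OF 0(1)] by blast
  then have "continuous_on S g"
    by (meson continuous_at_imp_continuous_on has_derivative_continuous)
  then show ?case
    using 0(2) by (simp cong: continuous_on_cong)
next
  case (Suc n f g)
  obtain D where D: "\<And>x. x \<in> S \<Longrightarrow> (g has_derivative D x) (at x)" "\<And>v. (\<lambda>x. D x v) \<in> C"
    using step[OF Suc.prems(1)] by blast
  have f: "(f has_derivative D x) (at x)" if "x \<in> S" for x
    using has_derivative_transform_within_open[OF D(1) S] that Suc.prems(2) by metis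
  have "Cn_on n (\<lambda>x. frechet_derivative f (at x) v) S" for v
    by (rule Suc.IH[OF D(2)[of v]]) (use f frechet_derivative_at in metis)
  then show ?case
    using f by (auto simp: differentiable_def)
qed

text \<open>A class to which the coinduction applies and which contains \<open>G / F\<close>. The inverse is the reason for
  carrying \<open>S\<close> along.\<close>

inductive_set exp_algebra :: "'a::real_normed_vector set \<Rightarrow> ('a \<Rightarrow> complex) set"
  for S :: "'a set" where
  const: "(\<lambda>_. c) \<in> exp_algebra S"
| exp: "bounded_linear L \<Longrightarrow> (\<lambda>x. exp (L x + c)) \<in> exp_algebra S"
| add: "f \<in> exp_algebra S \<Longrightarrow> g \<in> exp_algebra S \<Longrightarrow> (\<lambda>x. f x + g x) \<in> exp_algebra S"
| mult: "f \<in> exp_algebra S \<Longrightarrow> g \<in> exp_algebra S \<Longrightarrow> (\<lambda>x. f x * g x) \<in> exp_algebra S"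
| inverse: "f \<in> exp_algebra S \<Longrightarrow> \<forall>x\<in>S. f x \<noteq> 0 \<Longrightarrow> (\<lambda>x. inverse (f x)) \<in> exp_algebra S"

lemma exp_algebra_derivative:
  assumes "f \<in> exp_algebra S"
  shows "\<exists>D. (\<forall>x\<in>S. (f has_derivative D x) (at x)) \<and> (\<forall>v. (\<lambda>x. D x v) \<in> exp_algebra S)"
  using assms
proof induction
  case (const c)
  show ?case
    by (rule exI[of _ "\<lambda>_ _. 0"]) (auto intro: exp_algebra.const)
next
  case (exp L c)
  have "((\<lambda>x. exp (L x + c)) has_derivative (\<lambda>v. exp (L x + c) * L v)) (at x)" for x
  proof -
    have "((\<lambda>x. L x + c) has_derivative L) (at x)"
      using bounded_linear_imp_has_derivative[OF exp] by (simp add: has_derivative_add_const)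
    from has_derivative_compose[OF this DERIV_exp[unfolded has_field_derivative_def]]
    show ?thesis .
  qed
  then show ?case
    using exp
    by (intro exI[of _ "\<lambda>x v. exp (L x + c) * L v"]) (auto intro: exp_algebra.intros)
next
  case (add f g)
  then obtain D E where
    "\<And>x. x \<in> S \<Longrightarrow> (f has_derivative D x) (at x)" "\<And>v. (\<lambda>x. D x v) \<in> exp_algebra S"
    "\<And>x. x \<in> S \<Longrightarrow> (g has_derivative E x) (at x)" "\<And>v. (\<lambda>x. E x v) \<in> exp_algebra S"
    by blast
  then show ?case
    by (intro exI[of _ "\<lambda>x v. D x v + E x v"]) (auto intro!: exp_algebra.intros derivative_intros)
next
  case (mult f g)
  then obtain D E where
    "\<And>x. x \<in> S \<Longrightarrow> (f has_derivative D x) (at x)" "\<And>v. (\<lambda>x. D x v) \<in> exp_algebra S"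
    "\<And>x. x \<in> S \<Longrightarrow> (g has_derivative E x) (at x)" "\<And>v. (\<lambda>x. E x v) \<in> exp_algebra S"
    by blast
  with mult.hyps show ?case
    by (intro exI[of _ "\<lambda>x v. f x * E x v + D x v * g x"])
       (auto intro!: exp_algebra.intros derivative_intros)
next
  case (inverse f)
  then obtain D where D:
    "\<And>x. x \<in> S \<Longrightarrow> (f has_derivative D x) (at x)" "\<And>v. (\<lambda>x. D x v) \<in> exp_algebra S"
    by blast
  have "((\<lambda>x. inverse (f x)) has_derivative
          (\<lambda>v. - 1 * (inverse (f x) * D x v * inverse (f x)))) (at x)" if "x \<in> S" for x
    using Deriv.has_derivative_inverse[OF _ D(1)] that inverse.hyps(2) by simp
  moreover have "(\<lambda>x. - 1 * (inverse (f x) * D x v * inverse (f x))) \<in> exp_algebra S" for v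
    using inverse.hyps D(2) by (intro exp_algebra.intros) auto
  ultimately show ?case
    by (intro exI[of _ "\<lambda>x v. - 1 * (inverse (f x) * D x v * inverse (f x))"]) blast
qed

lemma smooth_on_exp_algebra:
  assumes "open S" "g \<in> exp_algebra S" "\<And>x. x \<in> S \<Longrightarrow> f x = g x"
  shows "smooth_on f S"
  unfolding smooth_on_def using Cn_on_coinduct[OF assms(1) exp_algebra_derivative assms(2,3)] by blast

section \<open>Tau functions and the bilinear equations\<close>

locale soliton_pair =
  fixes k1 k2 s :: real
  assumes k1: "0 < k1" and k12: "k1 < k2" and s: "s \<in> {1, - 1}"
begin

abbreviation (input) "\<gamma> \<equiv> soliton_gamma k1 k2"

lemma gamma: "\<gamma> > 1" "\<gamma> * (k2 - k1) = k2 + k1"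
  using k1 k12 by (auto simp: soliton_gamma_def field_simps)

lemma s_square: "s * s = 1"
  using s by auto

text \<open>Time is complexified, so that both variables can be treated with complex derivatives.\<close>

definition wave :: "real \<Rightarrow> complex \<Rightarrow> complex \<Rightarrow> complex" where
  "wave k z w = exp (- of_real k * z + of_real (k ^ 3) * w)"

lemma soliton_exp_eq: "soliton_exp k z t = wave k z (of_real t)"
  by (simp add: soliton_exp_def wave_def)

lemma wave_on_line:
  "wave k (of_real x - \<i> * of_real \<alpha>) (of_real t) = of_real (exp (- k * x + k ^ 3 * t)) * cis (k * \<alpha>)"
  by (simp add: wave_def cis_conv_exp exp_of_real[symmetric] exp_add[symmetric] algebra_simps)

text \<open>For \<open>\<sigma> = 1\<close> and \<open>\<sigma> = -1\<close> these are the two Hirota tau functions \<open>P\<close> and \<open>Q\<close> at \<open>m = n = 0\<close>, and in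
  general their mixed derivatives of order \<open>m\<close> in \<open>z\<close> and \<open>n\<close> in \<open>w\<close> (see \<open>tau_derivs\<close>). The
  constant term \<open>1\<close> survives for \<open>m = n = 0\<close> only, hence the power of \<open>0\<close>.\<close>

definition tau :: "real \<Rightarrow> nat \<Rightarrow> nat \<Rightarrow> complex \<Rightarrow> complex \<Rightarrow> complex" where
  "tau \<sigma> m n z w =
     0 ^ (m + n)
     - of_real (s * (- (k1 + k2)) ^ m * (k1 ^ 3 + k2 ^ 3) ^ n) * (wave k1 z w * wave k2 z w)
     + \<i> * of_real (\<sigma> * \<gamma>) *
         (of_real ((- k1) ^ m * (k1 ^ 3) ^ n) * wave k1 z w
          + of_real (s * (- k2) ^ m * (k2 ^ 3) ^ n) * wave k2 z w)"

lemma wave_derivs: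
  "((\<lambda>z. wave k z w) has_field_derivative - of_real k * wave k z w) (at z)"
  "((\<lambda>w. wave k z w) has_field_derivative of_real (k ^ 3) * wave k z w) (at w)"
  unfolding wave_def by (auto intro!: derivative_eq_intros)

lemma tau_derivs:
  "((\<lambda>z. tau \<sigma> m n z w) has_field_derivative tau \<sigma> (Suc m) n z w) (at z)"
  "((\<lambda>w. tau \<sigma> m n z w) has_field_derivative tau \<sigma> m (Suc n) z w) (at w)"
  unfolding tau_def
  by (rule derivative_eq_intros wave_derivs refl | simp add: algebra_simps)+

lemma soliton_F_eq: "soliton_F s k1 k2 z t = tau 1 0 0 z t * tau (-1) 0 0 z t"
proof -
  have *: "(A + \<i> * c * B) * (A - \<i> * c * B) = A\<^sup>2 + c\<^sup>2 * B\<^sup>2" for A B c :: complex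
    by (simp add: algebra_simps power2_eq_square)
  show ?thesis
    using *[of "1 - of_real s * (wave k1 z t * wave k2 z t)" "of_real \<gamma>"
        "wave k1 z t + of_real s * wave k2 z t"]
    by (simp add: soliton_F_def Let_def soliton_exp_eq tau_def algebra_simps)
qed

text \<open>\<open>G\<close> is the Wronskian of the two tau functions, so that \<open>u = \<i> s (P\<^sub>x / P - Q\<^sub>x / Q)\<close>.\<close>

lemma soliton_G_eq:
  "- 2 * \<i> * of_real (s * \<gamma>) * soliton_G s k1 k2 z t =
     tau 1 1 0 z t * tau (-1) 0 0 z t - tau 1 0 0 z t * tau (-1) 1 0 z t"
  using s
  by (auto simp add: soliton_G_def Let_def soliton_exp_eq tau_def algebra_simps power2_eq_square)

text \<open>The equations \<open>D\<^sub>x\<^sup>2 P \<cdot> Q = 0\<close> and \<open>(D\<^sub>t + D\<^sub>x\<^sup>3) P \<cdot> Q = 0\<close> in Hirota's notation. The second one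
  expresses the dispersion relation, which is built into \<^const>\<open>wave\<close>; the first one is the place where
  the value of \<open>\<gamma>\<close> enters, as \<open>\<gamma>\<^sup>2 (k\<^sub>2 - k\<^sub>1)\<^sup>2 = (k\<^sub>2 + k\<^sub>1)\<^sup>2\<close>.\<close>

lemma hirota_bilinear:
  fixes z w
  defines "p \<equiv> \<lambda>m n. tau 1 m n z w" and "q \<equiv> \<lambda>m n. tau (-1) m n z w"
  shows "p 2 0 * q 0 0 - 2 * p 1 0 * q 1 0 + p 0 0 * q 2 0 = 0"
    and "p 0 1 * q 0 0 - p 0 0 * q 0 1
         + p 3 0 * q 0 0 - 3 * p 2 0 * q 1 0 + 3 * p 1 0 * q 2 0 - p 0 0 * q 3 0 = 0"
proof -
  define a b where ab: "a = wave k1 z w" "b = wave k2 z w"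
  define K1 K2 S g I where cs: "K1 = complex_of_real k1" "K2 = complex_of_real k2"
    "S = complex_of_real s" "g = complex_of_real \<gamma>" "I = \<i>"
  note folds = ab[symmetric] cs[symmetric]
  have rels: "g * (K2 - K1) = K2 + K1" "S * S = 1" "I * I = - 1"
    unfolding cs using gamma(2) s_square
    by (metis of_real_add of_real_diff of_real_mult, metis of_real_1 of_real_mult, simp)
  show "p 2 0 * q 0 0 - 2 * p 1 0 * q 1 0 + p 0 0 * q 2 0 = 0"
    unfolding p_def q_def tau_def
    apply (simp add: folds power2_eq_square)
    using rels apply algebra
    done
  show "p 0 1 * q 0 0 - p 0 0 * q 0 1
         + p 3 0 * q 0 0 - 3 * p 2 0 * q 1 0 + 3 * p 1 0 * q 2 0 - p 0 0 * q 3 0 = 0"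
    unfolding p_def q_def tau_def
    by (simp add: power3_eq_cube power2_eq_square algebra_simps)
qed

section \<open>The mKdV equation\<close>

text \<open>Dividing by the tau function makes the derivatives closed under a Leibniz-type rule
  (\<open>tau_ratio_derivs\<close>), which avoids quotients with growing denominators.\<close>

definition tau_ratio :: "real \<Rightarrow> nat \<Rightarrow> nat \<Rightarrow> complex \<Rightarrow> complex \<Rightarrow> complex" where
  "tau_ratio \<sigma> m n z w = tau \<sigma> m n z w / tau \<sigma> 0 0 z w"

lemma tau_ratio_derivs:
  assumes "tau \<sigma> 0 0 z w \<noteq> 0"
  shows "((\<lambda>z. tau_ratio \<sigma> m n z w) has_field_derivative
            tau_ratio \<sigma> (Suc m) n z w - tau_ratio \<sigma> m n z w * tau_ratio \<sigma> 1 0 z w) (at z)"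
    and "((\<lambda>w. tau_ratio \<sigma> m n z w) has_field_derivative
            tau_ratio \<sigma> m (Suc n) z w - tau_ratio \<sigma> m n z w * tau_ratio \<sigma> 0 1 z w) (at w)"
  unfolding tau_ratio_def
  by (rule DERIV_cong[OF DERIV_divide[OF tau_derivs(1) tau_derivs(1) assms]]
        DERIV_cong[OF DERIV_divide[OF tau_derivs(2) tau_derivs(2) assms]];
      use assms in \<open>simp add: divide_simps\<close>)+

lemma D_x_eqI:
  assumes "\<And>y. u y t = g y" and "(g has_vector_derivative d) (at x)"
  shows "D_x u x t = d"
  using assms by (simp add: D_x_def vector_derivative_at)

text \<open>With \<open>w = log (P / Q)\<close>, dividing the bilinear equations by \<open>P Q\<close> and eliminating
  \<open>(log (P Q))\<^sub>x\<^sub>x = - w\<^sub>x\<^sup>2\<close> gives \<open>w\<^sub>t + w\<^sub>x\<^sub>x\<^sub>x = 2 w\<^sub>x\<^sup>3\<close>. Its derivative in \<open>x\<close> is the equation for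
  \<open>u = \<i> s w\<^sub>x\<close>. In the proof \<open>U0\<close> and \<open>W\<close> stand for \<open>w\<^sub>x\<close> and \<open>w\<^sub>t\<close>,
  which are differences of tau ratios.\<close>

lemma mKdV_quotient:
  assumes T: "open T"
    and nz: "\<And>t x. t \<in> T \<Longrightarrow> soliton_F s k1 k2 (of_real x - a) t \<noteq> 0"
    and v: "\<And>t x. t \<in> T \<Longrightarrow> v x t = 2 * of_real \<gamma> *
              (soliton_G s k1 k2 (of_real x - a) t / soliton_F s k1 k2 (of_real x - a) t)"
    and t: "t \<in> T"
  shows "D_t v x t + (D_x ^^ 3) v x t + 6 * (v x t)\<^sup>2 * D_x v x t = 0"
proof -
  define r where "r \<sigma> m n x t = tau_ratio \<sigma> m n (of_real x - a) (of_real t)" for \<sigma> m n x t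
  have r_x: "((\<lambda>y. r \<sigma> m n y t) has_vector_derivative r \<sigma> (Suc m) n x t - r \<sigma> m n x t * r \<sigma> 1 0 x t) (at x)"
    and r_t: "((\<lambda>t. r \<sigma> m n x t) has_vector_derivative r \<sigma> m (Suc n) x t - r \<sigma> m n x t * r \<sigma> 0 1 x t) (at t)"
    if "t \<in> T" "\<sigma> \<in> {1, -1}" for \<sigma> m n x t
  proof -
    have nz': "tau \<sigma> 0 0 (of_real x - a) (of_real t) \<noteq> 0"
      using nz[OF that(1), of x] that(2) by (auto simp: soliton_F_eq)
    have "((\<lambda>z. z - a) has_field_derivative 1) (at z)" for z
      by (auto intro!: derivative_eq_intros)
    from DERIV_chain2[OF tau_ratio_derivs(1)[OF nz'] this]
    show "((\<lambda>y. r \<sigma> m n y t) has_vector_derivative r \<sigma> (Suc m) n x t - r \<sigma> m n x t * r \<sigma> 1 0 x t) (at x)"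
      unfolding r_def by (intro has_vector_derivative_real_field) simp
    show "((\<lambda>t. r \<sigma> m n x t) has_vector_derivative r \<sigma> m (Suc n) x t - r \<sigma> m n x t * r \<sigma> 0 1 x t) (at t)"
      unfolding r_def by (intro has_vector_derivative_real_field tau_ratio_derivs(2) nz')
  qed
  define p where "p = r 1"
  define q where "q = r (-1)"
  have hirota1: "p 2 0 y t - 2 * p 1 0 y t * q 1 0 y t + q 2 0 y t = 0"
    and hirota2: "p 0 1 y t - q 0 1 y t + p 3 0 y t
       - 3 * p 2 0 y t * q 1 0 y t + 3 * p 1 0 y t * q 2 0 y t - q 3 0 y t = 0" for y
  proof -
    define P Q where "P = tau 1 0 0 (of_real y - a) (of_real t)"
      and "Q = tau (-1) 0 0 (of_real y - a) (of_real t)"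
    have "tau \<sigma> 0 0 (of_real y - a) (of_real t) \<noteq> 0" if "\<sigma> \<in> {1, -1}" for \<sigma>
      using nz[OF t, of y] that by (auto simp: soliton_F_eq)
    from this[of 1] this[of "-1"]
    have nz: "P \<noteq> 0" "Q \<noteq> 0"
      by (simp_all add: P_def Q_def)
    have "P * Q * (p 2 0 y t - 2 * p 1 0 y t * q 1 0 y t + q 2 0 y t) = 0"
      unfolding hirota_bilinear(1)[of "of_real y - a" "of_real t", symmetric]
      using nz by (simp add: p_def q_def r_def tau_ratio_def P_def Q_def field_simps)
    then show "p 2 0 y t - 2 * p 1 0 y t * q 1 0 y t + q 2 0 y t = 0"
      using nz by simp
    have "P * Q * (p 0 1 y t - q 0 1 y t + p 3 0 y t
       - 3 * p 2 0 y t * q 1 0 y t + 3 * p 1 0 y t * q 2 0 y t - q 3 0 y t) = 0"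
      unfolding hirota_bilinear(2)[of "of_real y - a" "of_real t", symmetric]
      using nz by (simp add: p_def q_def r_def tau_ratio_def P_def Q_def field_simps)
    then show "p 0 1 y t - q 0 1 y t + p 3 0 y t
       - 3 * p 2 0 y t * q 1 0 y t + 3 * p 1 0 y t * q 2 0 y t - q 3 0 y t = 0"
      using nz by simp
  qed
  define U0 where "U0 y = p 1 0 y t - q 1 0 y t" for y
  define U1 where "U1 y = p 2 0 y t - p 1 0 y t * p 1 0 y t - (q 2 0 y t - q 1 0 y t * q 1 0 y t)" for y
  define W where "W y = p 0 1 y t - q 0 1 y t" for y
  define W1 where "W1 y = p 1 1 y t - p 0 1 y t * p 1 0 y t - (q 1 1 y t - q 0 1 y t * q 1 0 y t)" for y
  note px = r_x[OF t, of 1, folded p_def, simplified] and qx = r_x[OF t, of "-1", folded q_def, simplified]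
  have U0: "(U0 has_vector_derivative U1 y) (at y)" for y
    unfolding U0_def U1_def
    by (rule derivative_eq_intros px qx refl | simp add: numeral_2_eq_2)+
  have W: "(W has_vector_derivative W1 y) (at y)" for y
    unfolding W_def W1_def
    by (rule derivative_eq_intros px qx refl | simp)+
  \<comment> \<open>Here \<open>w\<^sub>x\<^sub>x\<^sub>x = 2 w\<^sub>x\<^sup>3 - w\<^sub>t\<close> enters. It holds on the whole line at time \<open>t\<close>, so its
    right-hand side can be differentiated instead of the third-order expression in the tau ratios.\<close>
  have U1: "(U1 has_vector_derivative (2 * (U0 y * U0 y * U0 y) - W y)) (at y)" for y
    unfolding U1_def
    apply (rule derivative_eq_intros px qx refl)+
    using hirota1[of y] hirota2[of y] unfolding W_def U0_def
    apply (simp add: numeral_2_eq_2 numeral_3_eq_3)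
    apply algebra
    done
  have U2: "((\<lambda>y. 2 * (U0 y * U0 y * U0 y) - W y) has_vector_derivative 6 * (U0 y * U0 y * U1 y) - W1 y) (at y)" for y
    by (rule derivative_eq_intros U0 W refl | simp add: algebra_simps)+

  define c where "c = \<i> * complex_of_real s"
  have c: "c * c = -1"
    unfolding c_def using s by auto
  have v_eq: "v y t' = c * (p 1 0 y t' - q 1 0 y t')" if "t' \<in> T" for y t'
  proof -
    have nz': "tau \<sigma> 0 0 (of_real y - a) (of_real t') \<noteq> 0" if "\<sigma> \<in> {1, -1}" for \<sigma>
      using nz[OF \<open>t' \<in> T\<close>, of y] that by (auto simp: soliton_F_eq)
    have coeff: "c * (- 2 * \<i> * of_real (s * \<gamma>)) = 2 * of_real \<gamma>"
      unfolding c_def using s_square by (simp flip: of_real_mult add: algebra_simps)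
    have "c * (p 1 0 y t' - q 1 0 y t') = c * (- 2 * \<i> * of_real (s * \<gamma>)) *
        (soliton_G s k1 k2 (of_real y - a) t' / soliton_F s k1 k2 (of_real y - a) t')"
      using nz'[of 1] nz'[of "-1"] soliton_G_eq[of "of_real y - a" t']
      by (simp add: p_def q_def r_def tau_ratio_def soliton_F_eq field_simps)
    then show ?thesis
      unfolding coeff using v[OF that] by simp
  qed
  have v0: "v y t = c * U0 y" for y
    using v_eq[OF t] by (simp add: U0_def)
  have v1: "D_x v y t = c * U1 y" for y
    by (rule D_x_eqI[where u = v and g = "\<lambda>y. c * U0 y", OF v0]) (rule derivative_eq_intros U0 refl | simp)+
  have v2: "D_x (D_x v) y t = c * (2 * (U0 y * U0 y * U0 y) - W y)" for y
    by (rule D_x_eqI[where u = "D_x v" and g = "\<lambda>y. c * U1 y", OF v1]) (rule derivative_eq_intros U1 refl | simp)+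
  have v3: "D_x (D_x (D_x v)) y t = c * (6 * (U0 y * U0 y * U1 y) - W1 y)" for y
    by (rule D_x_eqI[where u = "D_x (D_x v)" and g = "\<lambda>y. c * (2 * (U0 y * U0 y * U0 y) - W y)", OF v2]) (rule derivative_eq_intros U2 refl | simp)+
  \<comment> \<open>The mixed derivatives agree: \<open>w\<^sub>x\<^sub>t = w\<^sub>t\<^sub>x\<close> is \<open>W1\<close> in both cases.\<close>
  have "((\<lambda>t. c * (p 1 0 x t - q 1 0 x t)) has_vector_derivative c * W1 x) (at t)"
    unfolding p_def q_def W1_def
    by (rule derivative_eq_intros r_t[OF t] refl | simp)+
  then have "((\<lambda>t. v x t) has_vector_derivative c * W1 x) (at t)"
    by (rule has_vector_derivative_transform_within_open[OF _ T t]) (simp add: v_eq)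
  then have "D_t v x t = c * W1 x"
    by (simp add: D_t_def vector_derivative_at)
  moreover have "(D_x ^^ 3) v x t = D_x (D_x (D_x v)) x t"
    by (simp add: numeral_3_eq_3)
  ultimately show ?thesis
    using c by (simp add: v0 v1 v3 power2_eq_square) algebra
qed

section \<open>Smoothness, poles and blow-up of the quotient\<close>

lemma soliton_exp_in_exp_algebra:
  "(\<lambda>p. soliton_exp k (of_real (fst p) - a) (snd p)) \<in> exp_algebra S"
proof -
  have "bounded_linear (\<lambda>p :: real \<times> real. - of_real k * of_real (fst p) + complex_of_real (k ^ 3) * of_real (snd p))"
    by (intro bounded_linear_add bounded_linear_compose[OF bounded_linear_mult_right]
          bounded_linear_compose[OF bounded_linear_of_real] bounded_linear_fst bounded_linear_snd)
  from exp_algebra.exp[OF this, of "of_real k * a" S] show ?thesis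
    by (simp add: soliton_exp_def algebra_simps)
qed

lemma smooth_on_quotient:
  assumes T: "open T"
    and nz: "\<And>t x. t \<in> T \<Longrightarrow> soliton_F s k1 k2 (of_real x - a) t \<noteq> 0"
    and v: "\<And>t x. t \<in> T \<Longrightarrow> v x t = 2 * of_real \<gamma> *
              (soliton_G s k1 k2 (of_real x - a) t / soliton_F s k1 k2 (of_real x - a) t)"
  shows "smooth_on (\<lambda>(x, t). v x t) (UNIV \<times> T)"
proof (rule smooth_on_exp_algebra)
  show "open (UNIV \<times> T)"
    using T by (simp add: open_Times)
  let ?A = "exp_algebra (UNIV \<times> T)"
  have F_eq: "soliton_F s k1 k2 z t =
      (1 + of_real (- s) * (soliton_exp k1 z t * soliton_exp k2 z t)) *
      (1 + of_real (- s) * (soliton_exp k1 z t * soliton_exp k2 z t)) +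
      of_real (\<gamma>\<^sup>2) *
        ((soliton_exp k1 z t + of_real s * soliton_exp k2 z t) *
         (soliton_exp k1 z t + of_real s * soliton_exp k2 z t))" for z t
    by (simp add: soliton_F_def Let_def power2_eq_square mult.assoc)
  have F: "(\<lambda>p. soliton_F s k1 k2 (of_real (fst p) - a) (snd p)) \<in> ?A"
    unfolding F_eq
    by (intro exp_algebra.add exp_algebra.mult exp_algebra.const soliton_exp_in_exp_algebra)
  have G: "(\<lambda>p. soliton_G s k1 k2 (of_real (fst p) - a) (snd p)) \<in> ?A"
    unfolding soliton_G_def Let_def power2_eq_square
    by (intro exp_algebra.add exp_algebra.mult exp_algebra.const soliton_exp_in_exp_algebra)
  show "(\<lambda>p. 2 * of_real \<gamma> * (soliton_G s k1 k2 (of_real (fst p) - a) (snd p) *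
            inverse (soliton_F s k1 k2 (of_real (fst p) - a) (snd p)))) \<in> ?A"
    using nz by (intro exp_algebra.mult exp_algebra.inverse exp_algebra.const F G) auto
qed (use v in \<open>auto simp: field_simps\<close>)

lemma soliton_analytic [analytic_intros]:
  assumes "g analytic_on A"
  shows "(\<lambda>z. soliton_G s k1 k2 (g z) t) analytic_on A"
    and "(\<lambda>z. soliton_F s k1 k2 (g z) t) analytic_on A"
  unfolding soliton_F_def soliton_G_def Let_def soliton_exp_def
  by (intro analytic_intros assms)+

text \<open>On the real axis \<open>F\<close> is a sum of two squares of real numbers which do not vanish together. This makes
  \<open>F\<close> a nonzero entire function, with isolated zeros.\<close>

lemma soliton_F_nonzero_at_0: "soliton_F s k1 k2 0 t \<noteq> 0"
proof
  assume *: "soliton_F s k1 k2 0 t = 0"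
  define a b where "a = exp (k1 ^ 3 * t)" "b = exp (k2 ^ 3 * t)"
  have "soliton_F s k1 k2 0 t = of_real ((1 - s * a * b)\<^sup>2 + \<gamma>\<^sup>2 * (a + s * b)\<^sup>2)"
    by (simp add: soliton_F_def soliton_exp_def a_b_def exp_of_real[symmetric] Let_def)
  with * have "(1 - s * a * b)\<^sup>2 + (\<gamma> * (a + s * b))\<^sup>2 = 0"
    by (simp only: of_real_eq_0_iff power_mult_distrib)
  then have "1 = s * a * b" "a + s * b = 0"
    using gamma(1) by (auto simp: sum_power2_eq_zero_iff)
  moreover have "a > 0" "b > 0"
    by (auto simp: a_b_def)
  ultimately show False
    using s by (auto simp: add_pos_pos less_imp_neq) (smt (verit) mult_pos_pos)+
qed

lemma eventually_soliton_F_nonzero: "\<forall>\<^sub>F z in at z0. soliton_F s k1 k2 (z - a) t \<noteq> 0"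
proof -
  have "(\<lambda>z. soliton_F s k1 k2 (z - a) t) holomorphic_on UNIV"
    by (intro analytic_imp_holomorphic analytic_intros)
  from non_zero_neighbour_alt[OF this, of z0 a] show ?thesis
    using soliton_F_nonzero_at_0 by (simp add: connected_UNIV)
qed

lemma two_soliton_eq:
  assumes "soliton_F s k1 k2 z t \<noteq> 0"
  shows "two_soliton s k1 k2 z t = 2 * of_real \<gamma> * (soliton_G s k1 k2 z t / soliton_F s k1 k2 z t)"
  unfolding two_soliton_def
  by (intro remove_sings_at_analytic analytic_intros) (use assms in auto)

lemma is_pole_two_soliton_iff:
  "is_pole (\<lambda>z. two_soliton s k1 k2 (z - a) t) z0 \<longleftrightarrow>
   is_pole (\<lambda>z. 2 * of_real \<gamma> * soliton_G s k1 k2 (z - a) t / soliton_F s k1 k2 (z - a) t) z0"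
  by (rule is_pole_cong[OF _ refl], rule eventually_mono[OF eventually_soliton_F_nonzero[of a t]])
     (simp add: two_soliton_eq)

lemma not_is_pole_two_soliton:
  assumes "soliton_F s k1 k2 (z0 - a) t \<noteq> 0"
  shows "\<not> is_pole (\<lambda>z. two_soliton s k1 k2 (z - a) t) z0"
  unfolding is_pole_two_soliton_iff
  by (intro analytic_at_imp_no_pole analytic_intros) (use assms in auto)

lemma is_pole_two_soliton:
  assumes "soliton_F s k1 k2 (z0 - a) t = 0" "soliton_G s k1 k2 (z0 - a) t \<noteq> 0"
  shows "is_pole (\<lambda>z. two_soliton s k1 k2 (z - a) t) z0"
  unfolding is_pole_two_soliton_iff
proof (rule is_pole_divide)
  have cont: "isCont (\<lambda>z. soliton_F s k1 k2 (z - a) t) z0"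
    by (intro analytic_at_imp_isCont analytic_intros)
  show "filterlim (\<lambda>z. soliton_F s k1 k2 (z - a) t) (at 0) (at z0)"
    using cont assms(1) eventually_soliton_F_nonzero by (auto simp: filterlim_at isCont_def)
  show "isCont (\<lambda>z. 2 * of_real \<gamma> * soliton_G s k1 k2 (z - a) t) z0"
    by (intro analytic_at_imp_isCont analytic_intros)
  show "2 * of_real \<gamma> * soliton_G s k1 k2 (z0 - a) t \<noteq> 0"
    using assms(2) gamma(1) by simp
qed

lemma two_soliton_norm_at_top:
  assumes F0: "soliton_F s k1 k2 z t0 = 0" and G0: "soliton_G s k1 k2 z t0 \<noteq> 0"
    and nz: "\<forall>\<^sub>F t in at_left t0. soliton_F s k1 k2 z t \<noteq> 0"
  shows "filterlim (\<lambda>t. norm (two_soliton s k1 k2 z t)) at_top (at_left t0)"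
proof -
  have cont: "isCont (\<lambda>t. soliton_F s k1 k2 z t) t0" "isCont (\<lambda>t. soliton_G s k1 k2 z t) t0"
    unfolding soliton_F_def soliton_G_def Let_def soliton_exp_def
    by (intro continuous_intros)+
  have lim: "((\<lambda>t. soliton_F s k1 k2 z t) \<longlongrightarrow> 0) (at_left t0)"
    "((\<lambda>t. soliton_G s k1 k2 z t) \<longlongrightarrow> soliton_G s k1 k2 z t0) (at_left t0)"
    using cont F0 by (auto simp: isCont_def intro: filterlim_mono at_le)
  have G_pos: "0 < 2 * \<gamma> * norm (soliton_G s k1 k2 z t0)"
    using gamma(1) G0 by simp
  have "filterlim (\<lambda>t. 2 * \<gamma> * norm (soliton_G s k1 k2 z t) / norm (soliton_F s k1 k2 z t)) at_top (at_left t0)"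
    using nz
    by (intro LIM_at_top_divide[OF _ G_pos] tendsto_intros lim tendsto_norm_zero) (auto elim: eventually_mono)
  moreover have "\<forall>\<^sub>F t in at_left t0. norm (two_soliton s k1 k2 z t) =
      2 * \<gamma> * norm (soliton_G s k1 k2 z t) / norm (soliton_F s k1 k2 z t)"
    using nz gamma(1) by (auto elim!: eventually_mono simp: two_soliton_eq norm_mult norm_divide)
  ultimately show ?thesis
    by (subst filterlim_cong[OF refl refl]) auto
qed

end

section \<open>Exponential decay\<close>

lemma exp_linear_tendsto_0: "((\<lambda>x::real. exp (- c * x + d)) \<longlongrightarrow> 0) at_top" if "c > 0" for c d :: real
proof -
  have "filterlim (\<lambda>x. exp (c * x)) at_top at_top"
    by (intro filterlim_compose[OF exp_at_top] filterlim_tendsto_pos_mult_at_top[OF tendsto_const that] filterlim_ident)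
  from tendsto_mult_right_zero[OF tendsto_inverse_0_at_top[OF this], of "exp d"] show ?thesis
    by (simp add: exp_diff divide_inverse mult.commute)
qed

context soliton_pair
begin

text \<open>\<open>G / F\<close> as a function of the values of \<open>f\<^sub>1\<close> and \<open>f\<^sub>2\<close>.\<close>

definition profile :: "complex \<Rightarrow> complex \<Rightarrow> complex" where
  "profile a b = (of_real s * of_real k1 * a * (1 + b\<^sup>2) + of_real k2 * b * (1 + a\<^sup>2)) /
     ((1 - of_real s * a * b)\<^sup>2 + of_real (\<gamma>\<^sup>2) * (a + of_real s * b)\<^sup>2)"

text \<open>This reduces the decay at the left end of the line, where the exponentials are large, to that at the
  right end.\<close>

lemma profile_inverse:
  assumes "a \<noteq> 0" "b \<noteq> 0"
  shows "profile (inverse a) (inverse b) = profile a b"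
proof -
  let ?N = "\<lambda>a b. of_real s * of_real k1 * a * (1 + b\<^sup>2) + of_real k2 * b * (1 + a\<^sup>2)"
  let ?D = "\<lambda>a b. (1 - of_real s * a * b)\<^sup>2 + of_real (\<gamma>\<^sup>2) * (a + of_real s * b)\<^sup>2"
  have "?N (inverse a) (inverse b) * (a * b)\<^sup>2 = ?N a b"
    using assms by (simp add: field_simps power2_eq_square)
  moreover have "?D (inverse a) (inverse b) * (a * b)\<^sup>2 = ?D a b"
    using assms s by (auto simp: field_simps power2_eq_square)
  ultimately show ?thesis
    unfolding profile_def using assms by (metis mult_divide_mult_cancel_right mult_eq_0_iff power_not_zero)
qed

text \<open>The wave with the smaller \<open>k\<close> dominates: the profile divided by \<open>g1\<close> tends to \<open>s k\<^sub>1\<close>.\<close>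

lemma profile_decay:
  assumes n1: "\<And>x. norm (g1 x) = exp (- k1 * x + d1)" and n2: "\<And>x. norm (g2 x) = exp (- k2 * x + d2)"
  shows "\<exists>C. \<forall>\<^sub>F x :: real in at_top. norm (profile (g1 x) (g2 x)) \<le> C * exp (- k1 * x)"
proof -
  have nz: "g1 x \<noteq> 0" for x
    using n1[of x] by (metis exp_not_eq_zero norm_zero)
  have lim: "(g1 \<longlongrightarrow> 0) at_top" "(g2 \<longlongrightarrow> 0) at_top" "((\<lambda>x. g2 x / g1 x) \<longlongrightarrow> 0) at_top"
  proof -
    have "norm (g2 x / g1 x) = exp (- (k2 - k1) * x + (d2 - d1))" for x
      by (simp add: norm_divide n1 n2 exp_diff[symmetric] algebra_simps)
    then show "(g1 \<longlongrightarrow> 0) at_top" "(g2 \<longlongrightarrow> 0) at_top" "((\<lambda>x. g2 x / g1 x) \<longlongrightarrow> 0) at_top"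
      using exp_linear_tendsto_0[of k1 d1] exp_linear_tendsto_0[of k2 d2]
        exp_linear_tendsto_0[of "k2 - k1" "d2 - d1"] k1 k12
      by (simp_all add: n1 n2 flip: tendsto_norm_zero_iff[of g1] tendsto_norm_zero_iff[of g2]
          tendsto_norm_zero_iff[of "\<lambda>x. g2 x / g1 x"])
  qed
  have "((\<lambda>x. (of_real s * of_real k1 * (1 + (g2 x)\<^sup>2) + of_real k2 * (g2 x / g1 x) * (1 + (g1 x)\<^sup>2)) /
            ((1 - of_real s * g1 x * g2 x)\<^sup>2 + of_real (\<gamma>\<^sup>2) * (g1 x + of_real s * g2 x)\<^sup>2))
        \<longlongrightarrow> (of_real s * of_real k1 * (1 + 0\<^sup>2) + of_real k2 * 0 * (1 + 0\<^sup>2)) /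
            ((1 - of_real s * 0 * 0)\<^sup>2 + of_real (\<gamma>\<^sup>2) * (0 + of_real s * 0)\<^sup>2)) at_top"
    by (intro tendsto_intros lim) simp
  moreover have "(of_real s * of_real k1 * (1 + (g2 x)\<^sup>2) + of_real k2 * (g2 x / g1 x) * (1 + (g1 x)\<^sup>2)) /
            ((1 - of_real s * g1 x * g2 x)\<^sup>2 + of_real (\<gamma>\<^sup>2) * (g1 x + of_real s * g2 x)\<^sup>2)
       = profile (g1 x) (g2 x) / g1 x" for x
    using nz[of x] by (simp add: profile_def add_divide_distrib mult_ac)
  ultimately have lim_ratio: "((\<lambda>x. profile (g1 x) (g2 x) / g1 x) \<longlongrightarrow> of_real (s * k1)) at_top"
    by simp
  have norm_g1: "norm (g1 x) = exp d1 * exp (- k1 * x)" for x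
    by (simp add: n1 exp_add[symmetric] add.commute)
  from tendsto_norm[OF lim_ratio] have "\<forall>\<^sub>F x in at_top. norm (profile (g1 x) (g2 x) / g1 x) < k1 + 1"
    using s k1 by (intro order_tendstoD(2)[of _ "norm (complex_of_real (s * k1))"]) (auto simp: norm_mult)
  then have "\<forall>\<^sub>F x in at_top. norm (profile (g1 x) (g2 x)) \<le> (k1 + 1) * exp d1 * exp (- k1 * x)"
    by eventually_elim (simp add: norm_divide norm_g1 pos_divide_less_eq mult_ac less_imp_le)
  then show ?thesis
    by blast
qed

lemma exp_decay_two_soliton:
  assumes nz: "\<And>x. soliton_F s k1 k2 (of_real x - \<i> * of_real \<alpha>) t \<noteq> 0"
  shows "exp_decay (\<lambda>x. two_soliton s k1 k2 (of_real x - \<i> * of_real \<alpha>) t)"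
proof -
  define f where "f k x = wave k (of_real x - \<i> * of_real \<alpha>) (of_real t)" for k and x :: real
  have norm_f: "norm (f k x) = exp (- k * x + k ^ 3 * t)" for k x
    unfolding f_def wave_on_line by (simp add: norm_mult)
  have f_nz: "f k x \<noteq> 0" for k x
    by (simp add: f_def wave_def)
  have eq: "two_soliton s k1 k2 (of_real x - \<i> * of_real \<alpha>) t = 2 * of_real \<gamma> * profile (f k1 x) (f k2 x)" for x
    unfolding two_soliton_eq[OF nz]
    by (simp add: soliton_F_def soliton_G_def profile_def f_def soliton_exp_eq Let_def)
  obtain C1 where C1: "\<forall>\<^sub>F x in at_top. norm (profile (f k1 x) (f k2 x)) \<le> C1 * exp (- k1 * x)"
    using profile_decay[OF norm_f norm_f] by blast
  have "norm (inverse (f k (- x))) = exp (- k * x + - (k ^ 3 * t))" for k x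
    by (simp add: norm_inverse norm_f exp_minus[symmetric] algebra_simps)
  from profile_decay[OF this this] obtain C2 where
    C2: "\<forall>\<^sub>F x in at_top. norm (profile (f k1 (- x)) (f k2 (- x))) \<le> C2 * exp (- k1 * x)"
    using f_nz by (auto simp: profile_inverse)
  define C where "C = 2 * \<gamma> * max C1 C2"
  have le: "2 * \<gamma> * y \<le> C * exp (- k1 * \<bar>x\<bar>)" if "y \<le> C' * exp (- k1 * \<bar>x\<bar>)" "C' \<in> {C1, C2}" for x y C'
  proof -
    have "y \<le> max C1 C2 * exp (- k1 * \<bar>x\<bar>)"
      using that by (elim order_trans) (auto intro!: mult_right_mono)
    then show ?thesis
      using gamma(1) by (simp add: C_def mult.assoc)
  qed
  have norm_eq: "norm (two_soliton s k1 k2 (of_real x - \<i> * of_real \<alpha>) t) = 2 * \<gamma> * norm (profile (f k1 x) (f k2 x))" for x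
    unfolding eq using gamma(1) by (simp add: norm_mult)
  have "\<forall>\<^sub>F x in at_top. norm (two_soliton s k1 k2 (of_real x - \<i> * of_real \<alpha>) t) \<le> C * exp (- k1 * \<bar>x\<bar>)"
    using C1 eventually_ge_at_top[of 0] unfolding norm_eq
    by eventually_elim (rule le[where C' = C1], auto)
  moreover have "\<forall>\<^sub>F x in at_top. norm (two_soliton s k1 k2 (of_real (- x) - \<i> * of_real \<alpha>) t) \<le> C * exp (- k1 * \<bar>- x\<bar>)"
    using C2 eventually_ge_at_top[of 0] unfolding norm_eq
    by eventually_elim (rule le[where C' = C2], auto)
  ultimately have "\<forall>\<^sub>F x in at_infinity. norm (two_soliton s k1 k2 (of_real x - \<i> * of_real \<alpha>) t) \<le> C * exp (- k1 * \<bar>x\<bar>)"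
    unfolding at_infinity_eq_at_top_bot eventually_sup at_bot_mirror eventually_filtermap by blast
  then show ?thesis
    unfolding exp_decay_def using k1 by blast
qed

lemma smooth_mKdV_two_soliton:
  assumes "open T" "\<And>t x. t \<in> T \<Longrightarrow> soliton_F s k1 k2 (of_real x - a) t \<noteq> 0"
  shows "smooth_mKdV_solution (\<lambda>x t. two_soliton s k1 k2 (of_real x - a) t) T"
  unfolding smooth_mKdV_solution_def
  using smooth_on_quotient[OF assms two_soliton_eq] mKdV_quotient[OF assms two_soliton_eq] assms(2) by simp

section \<open>Zeros of the tau functions on a horizontal line\<close>

text \<open>The second hypothesis says that \<open>G = 0\<close>, given the first one. If \<open>P = Q = 0\<close>, then \<open>s f\<^sub>2 = - f\<^sub>1\<close> and
  \<open>s f\<^sub>1 f\<^sub>2 = 1\<close>. If \<open>P = P\<^sub>x = 0\<close>, then eliminating \<open>f\<^sub>2\<close> leaves a quadratic equation for \<open>f\<^sub>1\<close>,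
  which turns out to be a perfect square with the double root \<open>\<i>\<close>.\<close>

lemma double_zero_imp_imaginary:
  assumes P: "tau 1 0 0 z w = 0" and G: "tau 1 1 0 z w * tau (-1) 0 0 z w = 0"
  shows "(wave k1 z w)\<^sup>2 = -1"
proof -
  define a b where ab: "a = wave k1 z w" "b = wave k2 z w"
  define K1 K2 S g I where cs: "K1 = complex_of_real k1" "K2 = complex_of_real k2"
    "S = complex_of_real s" "g = complex_of_real \<gamma>" "I = \<i>"
  note folds = ab[symmetric] cs[symmetric]
  have rels: "g * (K2 - K1) = K2 + K1" "S * S = 1" "I * I = - 1"
    unfolding cs using gamma(2) s_square
    by (metis of_real_add of_real_diff of_real_mult, metis of_real_1 of_real_mult, simp)
  have nz: "K2 \<noteq> 0" "K2 - K1 \<noteq> 0" "K1 \<noteq> 0" "g \<noteq> 0"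
    using k1 k12 gamma(1) by (auto simp: cs)
  have P0: "1 - S * (a * b) + I * g * (a + S * b) = 0"
    using P by (simp add: tau_def folds)
  from G consider "tau (-1) 0 0 z w = 0" | "tau 1 1 0 z w = 0" by auto
  then have "a * a = - 1"
  proof cases
    case 1
    then have Q0: "1 - S * (a * b) - I * g * (a + S * b) = 0"
      by (simp add: tau_def folds)
    have "1 - S * (a * b) = 0"
      using P0 Q0 by algebra
    moreover have "I * g * (a + S * b) = 0"
      using P0 Q0 by algebra
    then have "a + S * b = 0"
      using nz(4) cs(5) by simp
    ultimately show ?thesis by algebra
  next
    case 2
    then have P1: "S * (K1 + K2) * (a * b) = I * g * (K1 * a + S * K2 * b)"
      by (simp add: tau_def folds algebra_simps)
    have *: "(K2 - K1) * (1 - S * (a * b)) + I * (K2 + K1) * (a + S * b) = 0"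
      using P0 rels(1) by algebra
    have "(K2 + K1) * (S * (a * b) * (K2 - K1) - I * (K1 * a + S * K2 * b)) = 0"
      using P1 rels(1) by algebra
    moreover have "K2 + K1 \<noteq> 0"
      using k1 k12 unfolding cs by (metis add_pos_pos less_trans of_real_add of_real_eq_0_iff less_irrefl)
    ultimately have **: "S * (a * b) * (K2 - K1) - I * (K1 * a + S * K2 * b) = 0"
      by simp
    have "(K2 - K1) + I * (K2 * a + S * K1 * b) = 0"
      using * ** by algebra
    then have "K2 * (K2 - K1) * ((a - I) * (a - I)) = 0"
      using ** rels(2,3) nz(3) by algebra
    then have "a = I"
      using nz by simp
    then show ?thesis
      using rels by simp
  qed
  then show ?thesis
    by (simp add: ab power2_eq_square)
qed

text \<open>The real and the imaginary part, with the terms in \<open>r2\<close> on the right: both are linear in \<open>r2\<close>, which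
  prepares its elimination.\<close>

lemma tau_zero_iff:
  assumes f: "wave k1 z w = of_real r1 * cis \<theta>1" "wave k2 z w = of_real r2 * cis \<theta>2"
  shows "tau \<sigma> 0 0 z w = 0 \<longleftrightarrow>
    1 - \<sigma> * \<gamma> * r1 * sin \<theta>1 = s * r2 * (r1 * cos (\<theta>1 + \<theta>2) + \<sigma> * \<gamma> * sin \<theta>2) \<and>
    \<sigma> * \<gamma> * r1 * cos \<theta>1 = s * r2 * (r1 * sin (\<theta>1 + \<theta>2) - \<sigma> * \<gamma> * cos \<theta>2)"
  by (auto simp: tau_def f complex_eq_iff cos_add sin_add algebra_simps)

text \<open>The determinant of the two equations of \<open>tau_zero_iff\<close>, whose vanishing eliminates \<open>r2\<close>: a
  polynomial in \<open>r1\<close> of degree two with equal outer coefficients.\<close>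

lemma tau_eliminant:
  fixes r1 \<theta>1 \<theta>2 \<sigma> :: real
  assumes "\<sigma> * \<sigma> = 1"
  shows "(1 - \<sigma> * \<gamma> * r1 * sin \<theta>1) * (r1 * sin (\<theta>1 + \<theta>2) - \<sigma> * \<gamma> * cos \<theta>2)
      - \<sigma> * \<gamma> * r1 * cos \<theta>1 * (r1 * cos (\<theta>1 + \<theta>2) + \<sigma> * \<gamma> * sin \<theta>2)
    = r1 * ((1 + \<gamma>\<^sup>2) * sin \<theta>1 * cos \<theta>2 + (1 - \<gamma>\<^sup>2) * cos \<theta>1 * sin \<theta>2)
      - \<sigma> * \<gamma> * cos \<theta>2 * (1 + r1\<^sup>2)"
proof -
  have "sin \<theta>1 * sin \<theta>1 = 1 - cos \<theta>1 * cos \<theta>1"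
    using sin_cos_squared_add3[of \<theta>1] by linarith
  then show ?thesis
    unfolding sin_add cos_add power2_eq_square using assms by algebra
qed

text \<open>The time at which two waves have given amplitudes: the solution for \<open>t\<close> of the linear system
  \<open>- k\<^sub>j x + k\<^sub>j\<^sup>3 t = ln r\<^sub>j\<close>.\<close>

definition time_of_amplitudes :: "real \<Rightarrow> real \<Rightarrow> real" where
  "time_of_amplitudes r1 r2 = (k1 * ln r2 - k2 * ln r1) / (k1 * k2 * (k2\<^sup>2 - k1\<^sup>2))"

lemma time_denominator_nonzero: "k1 * k2 * (k2\<^sup>2 - k1\<^sup>2) \<noteq> 0"
  using k1 k12 by (simp add: power2_eq_iff)

lemma time_of_amplitudes_exp:
  "time_of_amplitudes (exp (- k1 * x + k1 ^ 3 * t)) (exp (- k2 * x + k2 ^ 3 * t)) = t"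
  using time_denominator_nonzero by (simp add: time_of_amplitudes_def divide_simps) algebra

lemma amplitudes_realised:
  assumes "0 < r1" "0 < r2"
  obtains x t where "exp (- k1 * x + k1 ^ 3 * t) = r1" "exp (- k2 * x + k2 ^ 3 * t) = r2"
proof
  let ?t = "time_of_amplitudes r1 r2"
  let ?x = "k1\<^sup>2 * ?t - ln r1 / k1"
  have "- k1 * ?x + k1 ^ 3 * ?t = ln r1"
    using k1 by (simp add: field_simps power2_eq_square power3_eq_cube)
  then show "exp (- k1 * ?x + k1 ^ 3 * ?t) = r1"
    using assms by simp
  have "- k2 * ?x + k2 ^ 3 * ?t = k2 * (k2\<^sup>2 - k1\<^sup>2) * ?t + k2 * ln r1 / k1"
    by (simp add: algebra_simps power2_eq_square power3_eq_cube)
  also have "\<dots> = ln r2"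
    unfolding time_of_amplitudes_def using time_denominator_nonzero k1 by (simp add: field_simps)
  finally show "exp (- k2 * ?x + k2 ^ 3 * ?t) = r2"
    using assms by simp
qed

text \<open>The amplitude \<open>r1\<close> is a root of one of two nonzero quadratic polynomials, by \<open>cos (k\<^sub>2 \<alpha>) \<noteq> 0\<close>; it
  determines \<open>r2\<close>, by \<open>cos (k\<^sub>1 \<alpha>) \<noteq> 0\<close>; and both amplitudes determine the time.\<close>

lemma finite_singular_times:
  assumes c1: "cos (k1 * \<alpha>) \<noteq> 0" and c2: "cos (k2 * \<alpha>) \<noteq> 0"
  shows "finite {t. \<exists>x. soliton_F s k1 k2 (of_real x - \<i> * of_real \<alpha>) t = 0}"
proof -
  define \<theta>1 \<theta>2 where th: "\<theta>1 = k1 * \<alpha>" "\<theta>2 = k2 * \<alpha>"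
  define c where "c = (1 + \<gamma>\<^sup>2) * sin \<theta>1 * cos \<theta>2 + (1 - \<gamma>\<^sup>2) * cos \<theta>1 * sin \<theta>2"
  define R where "R \<sigma> = {r. poly [:\<sigma> * \<gamma> * cos \<theta>2, - c, \<sigma> * \<gamma> * cos \<theta>2:] r = 0}" for \<sigma>
  define h where "h \<sigma> r = s * \<sigma> * \<gamma> * r * cos \<theta>1 / (r * sin (\<theta>1 + \<theta>2) - \<sigma> * \<gamma> * cos \<theta>2)" for \<sigma> r
  have "finite (R \<sigma>)" if "\<sigma> \<in> {1, -1}" for \<sigma>
    unfolding R_def using that c2 gamma(1) th by (intro poly_roots_finite) auto
  then have fin: "finite (\<Union>\<sigma>\<in>{1, -1}. (\<lambda>r. time_of_amplitudes r (h \<sigma> r)) ` R \<sigma>)"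
    by blast
  have mem: "t \<in> (\<Union>\<sigma>\<in>{1, -1}. (\<lambda>r. time_of_amplitudes r (h \<sigma> r)) ` R \<sigma>)"
    if F: "soliton_F s k1 k2 (of_real x - \<i> * of_real \<alpha>) t = 0" for x t
  proof -
    define r1 r2 where r: "r1 = exp (- k1 * x + k1 ^ 3 * t)" "r2 = exp (- k2 * x + k2 ^ 3 * t)"
    have pos: "r1 > 0" "r2 > 0" by (auto simp: r)
    obtain \<sigma> where \<sigma>: "\<sigma> \<in> {1, -1}" "tau \<sigma> 0 0 (of_real x - \<i> * of_real \<alpha>) (of_real t) = 0"
      using F unfolding soliton_F_eq by auto
    define D N where "D = r1 * sin (\<theta>1 + \<theta>2) - \<sigma> * \<gamma> * cos \<theta>2"
      and "N = r1 * cos (\<theta>1 + \<theta>2) + \<sigma> * \<gamma> * sin \<theta>2"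
    have eqs: "1 - \<sigma> * \<gamma> * r1 * sin \<theta>1 = s * r2 * N" "\<sigma> * \<gamma> * r1 * cos \<theta>1 = s * r2 * D"
      using \<sigma>(2) unfolding tau_zero_iff[OF wave_on_line wave_on_line] D_def N_def r th by auto
    have "(1 - \<sigma> * \<gamma> * r1 * sin \<theta>1) * D - \<sigma> * \<gamma> * r1 * cos \<theta>1 * N = 0"
      unfolding eqs by simp
    then have "r1 * c - \<sigma> * \<gamma> * cos \<theta>2 * (1 + r1\<^sup>2) = 0"
      using tau_eliminant[of \<sigma> r1 \<theta>1 \<theta>2] \<sigma>(1) unfolding D_def N_def c_def by auto
    then have "r1 \<in> R \<sigma>"
      by (simp add: R_def algebra_simps power2_eq_square)
    moreover have "D \<noteq> 0"
      using eqs(2) \<sigma>(1) gamma(1) pos c1 th by auto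
    then have "r2 = h \<sigma> r1"
      using eqs(2) s_square unfolding h_def D_def[symmetric] by (simp add: field_simps) algebra
    ultimately show ?thesis
      using \<sigma>(1) time_of_amplitudes_exp[of x t] unfolding r[symmetric] by force
  qed
  show ?thesis
    by (rule finite_subset[OF _ fin]) (use mem in blast)
qed

text \<open>With \<open>k\<^sub>2 \<alpha> = s \<pi> / 2 + \<eta>\<close> the quadratic equation for \<open>r1\<close> reads \<open>r1 + 1 / r1 = h\<close>, where \<open>h\<close> is the same
  for both signs. The assumption \<open>disc\<close> is \<open>h \<ge> 2\<close>, so there is a positive root; the condition on
  \<open>cos (\<theta>1 + \<eta>)\<close> makes the corresponding \<open>r2\<close> positive.\<close>

lemma tau_zero_exists:
  fixes \<eta> \<alpha> :: real
  defines "\<theta>1 \<equiv> k1 * \<alpha>"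
  assumes \<alpha>: "k2 * \<alpha> = s * pi / 2 + \<eta>" and sin_pos: "sin \<eta> > 0"
    and cos_pos: "cos \<theta>1 > 0" "cos (\<theta>1 + \<eta>) > 0"
    and disc: "2 * \<gamma> * sin \<eta> \<le> (\<gamma>\<^sup>2 + 1) * sin \<theta>1 * sin \<eta> + (\<gamma>\<^sup>2 - 1) * cos \<theta>1 * cos \<eta>"
  obtains x t where "tau 1 0 0 (of_real x - \<i> * of_real \<alpha>) (of_real t) = 0"
proof -
  define \<theta>2 where "\<theta>2 = k2 * \<alpha>"
  have t2: "cos \<theta>2 = - s * sin \<eta>" "sin \<theta>2 = s * cos \<eta>"
    using s by (auto simp: \<theta>2_def \<alpha> cos_add sin_add)
  define h where "h = ((\<gamma>\<^sup>2 + 1) * sin \<theta>1 * sin \<eta> + (\<gamma>\<^sup>2 - 1) * cos \<theta>1 * cos \<eta>) / (\<gamma> * sin \<eta>)"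
  have h_eq: "h * (\<gamma> * sin \<eta>) = (\<gamma>\<^sup>2 + 1) * sin \<theta>1 * sin \<eta> + (\<gamma>\<^sup>2 - 1) * cos \<theta>1 * cos \<eta>"
    using sin_pos gamma(1) by (simp add: h_def)
  have h2: "h \<ge> 2"
    using disc sin_pos gamma(1) by (simp add: h_def field_simps)
  define r1 where "r1 = (h + sqrt (h\<^sup>2 - 4)) / 2"
  have "h\<^sup>2 \<ge> 2\<^sup>2"
    using h2 by (intro power_mono) auto
  then have "1 + r1\<^sup>2 = h * r1" "r1 > 0"
    using h2 by (auto simp: r1_def field_simps power2_eq_square add_pos_nonneg)
  note r1 = this
  define D N where "D = r1 * sin (\<theta>1 + \<theta>2) - \<gamma> * cos \<theta>2"
    and "N = r1 * cos (\<theta>1 + \<theta>2) + \<gamma> * sin \<theta>2"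
  have "s * D = r1 * cos (\<theta>1 + \<eta>) + \<gamma> * sin \<eta>"
    unfolding D_def sin_add cos_add t2 using s by (auto simp: algebra_simps)
  then have sD: "s * D > 0"
    using r1 cos_pos gamma(1) sin_pos by (simp add: add_pos_pos)
  define r2 where "r2 = \<gamma> * r1 * cos \<theta>1 / (s * D)"
  have r2: "r2 > 0" "\<gamma> * r1 * cos \<theta>1 = s * r2 * D"
    using sD r1 cos_pos gamma(1) by (auto simp: r2_def)
  have "r1 * ((1 + \<gamma>\<^sup>2) * sin \<theta>1 * cos \<theta>2 + (1 - \<gamma>\<^sup>2) * cos \<theta>1 * sin \<theta>2) = r1 * (- s * (h * (\<gamma> * sin \<eta>)))"
    unfolding h_eq t2 by (simp add: algebra_simps)
  also have "\<dots> = \<gamma> * cos \<theta>2 * (1 + r1\<^sup>2)"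
    unfolding r1 t2 by simp
  finally have "(1 - \<gamma> * r1 * sin \<theta>1) * D = \<gamma> * r1 * cos \<theta>1 * N"
    using tau_eliminant[of 1 r1 \<theta>1 \<theta>2] by (simp add: D_def N_def)
  then have "(1 - \<gamma> * r1 * sin \<theta>1) * D = (s * r2 * N) * D"
    unfolding r2(2) by (simp only: mult_ac)
  then have eq1: "1 - \<gamma> * r1 * sin \<theta>1 = s * r2 * N"
    using mult_right_cancel[of D] sD by (metis less_irrefl mult_zero_right)
  obtain x t where "exp (- k1 * x + k1 ^ 3 * t) = r1" "exp (- k2 * x + k2 ^ 3 * t) = r2"
    using amplitudes_realised r1(2) r2(1) by metis
  with eq1 r2(2) have "tau 1 0 0 (of_real x - \<i> * of_real \<alpha>) (of_real t) = 0"
    unfolding tau_zero_iff[OF wave_on_line wave_on_line] D_def N_def \<theta>2_def \<theta>1_def by simp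
  then show ?thesis
    by (rule that)
qed

text \<open>As \<open>\<eta>\<close> decreases to \<open>0\<close>, the angle \<open>k\<^sub>1 \<alpha>\<close> tends to \<open>s \<pi> k\<^sub>1 / (2 k\<^sub>2)\<close>, which lies strictly between
  \<open>- \<pi> / 2\<close> and \<open>\<pi> / 2\<close>. So both cosines have a positive limit, and the last inequality tends to
  \<open>0 < (\<gamma>\<^sup>2 - 1) cos (k\<^sub>1 \<alpha>)\<close>, which is true because of \<open>\<gamma> > 1\<close>.\<close>

lemma exists_admissible_line:
  obtains \<alpha> \<eta> where "k2 * \<alpha> = s * pi / 2 + \<eta>" "sin \<eta> > 0" "cos (k1 * \<alpha>) > 0" "cos (k1 * \<alpha> + \<eta>) > 0"
    "2 * \<gamma> * sin \<eta> \<le> (\<gamma>\<^sup>2 + 1) * sin (k1 * \<alpha>) * sin \<eta> + (\<gamma>\<^sup>2 - 1) * cos (k1 * \<alpha>) * cos \<eta>"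
proof -
  define A where "A \<eta> = (s * pi / 2 + \<eta>) / k2" for \<eta>
  define \<Phi> where "\<Phi> \<eta> = (\<gamma>\<^sup>2 + 1) * sin (k1 * A \<eta>) * sin \<eta> + (\<gamma>\<^sup>2 - 1) * cos (k1 * A \<eta>) * cos \<eta> - 2 * \<gamma> * sin \<eta>" for \<eta>
  have "k1 * A 0 = s * (pi / 2 * (k1 / k2))"
    by (simp add: A_def)
  then have "cos (k1 * A 0) = cos (pi / 2 * (k1 / k2))"
    using s by auto
  moreover have "cos (pi / 2 * (k1 / k2)) > 0"
    using k1 k12 by (intro cos_gt_zero) (auto simp: field_simps)
  ultimately have c0: "cos (k1 * A 0) > 0" by simp
  have \<Phi>0: "\<Phi> 0 > 0"
    using c0 gamma(1) by (simp add: \<Phi>_def)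
  have lim: "(f \<longlongrightarrow> f 0) (at_right 0)" if "isCont f 0" for f :: "real \<Rightarrow> real"
    using that by (auto simp: isCont_def intro: filterlim_mono at_le)
  have ev: "\<forall>\<^sub>F \<eta> in at_right 0. f \<eta> > 0" if "isCont f 0" "f 0 > 0" for f :: "real \<Rightarrow> real"
    using order_tendstoD(1)[OF lim[OF that(1)] that(2)] .
  have "\<forall>\<^sub>F \<eta> in at_right 0. cos (k1 * A \<eta>) > 0" "\<forall>\<^sub>F \<eta> in at_right 0. cos (k1 * A \<eta> + \<eta>) > 0"
    "\<forall>\<^sub>F \<eta> in at_right 0. \<Phi> \<eta> > 0"
    by (rule ev; use c0 \<Phi>0 k1 k12 in \<open>auto simp: A_def \<Phi>_def intro!: continuous_intros\<close>)+
  moreover have "\<forall>\<^sub>F \<eta> in at_right 0. \<eta> \<in> {0<..<pi}"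
    by (intro eventually_at_right_real) simp
  ultimately have "\<forall>\<^sub>F \<eta> in at_right 0. cos (k1 * A \<eta>) > 0 \<and> cos (k1 * A \<eta> + \<eta>) > 0 \<and> \<Phi> \<eta> > 0 \<and> \<eta> \<in> {0<..<pi}"
    by eventually_elim auto
  then obtain \<eta> where "cos (k1 * A \<eta>) > 0" "cos (k1 * A \<eta> + \<eta>) > 0" "\<Phi> \<eta> > 0" "\<eta> \<in> {0<..<pi}"
    using eventually_happens[of _ "at_right (0::real)"] by (auto simp: trivial_limit_at_right_real)
  then show ?thesis
    using k1 k12 by (intro that[of "A \<eta>" \<eta>]) (auto simp: \<Phi>_def sin_gt_zero A_def)
qed

lemma exists_isolated_crossing:
  obtains \<alpha> t0 \<delta> x0 where "\<delta> > 0"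
    "\<And>t x. 0 < \<bar>t - t0\<bar> \<Longrightarrow> \<bar>t - t0\<bar> < \<delta> \<Longrightarrow> soliton_F s k1 k2 (of_real x - \<i> * of_real \<alpha>) t \<noteq> 0"
    "soliton_F s k1 k2 (of_real x0 - \<i> * of_real \<alpha>) t0 = 0"
    "soliton_G s k1 k2 (of_real x0 - \<i> * of_real \<alpha>) t0 \<noteq> 0"
proof -
  obtain \<alpha> \<eta> where line: "k2 * \<alpha> = s * pi / 2 + \<eta>" "sin \<eta> > 0" "cos (k1 * \<alpha>) > 0" "cos (k1 * \<alpha> + \<eta>) > 0"
    "2 * \<gamma> * sin \<eta> \<le> (\<gamma>\<^sup>2 + 1) * sin (k1 * \<alpha>) * sin \<eta> + (\<gamma>\<^sup>2 - 1) * cos (k1 * \<alpha>) * cos \<eta>"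
    by (rule exists_admissible_line)
  obtain x0 t0 where P: "tau 1 0 0 (of_real x0 - \<i> * of_real \<alpha>) (of_real t0) = 0"
    by (rule tau_zero_exists[OF line])
  have "cos (k2 * \<alpha>) = - s * sin \<eta>"
    unfolding line(1) using s by (auto simp: cos_add)
  then have c2: "cos (k2 * \<alpha>) \<noteq> 0"
    using line(2) s by auto
  have F0: "soliton_F s k1 k2 (of_real x0 - \<i> * of_real \<alpha>) t0 = 0"
    by (simp add: soliton_F_eq P)
  have G0: "soliton_G s k1 k2 (of_real x0 - \<i> * of_real \<alpha>) t0 \<noteq> 0"
  proof
    assume "soliton_G s k1 k2 (of_real x0 - \<i> * of_real \<alpha>) t0 = 0"
    then have "(wave k1 (of_real x0 - \<i> * of_real \<alpha>) (of_real t0))\<^sup>2 = - 1"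
      using soliton_G_eq[of "of_real x0 - \<i> * of_real \<alpha>" t0] P by (intro double_zero_imp_imaginary) auto
    then have "Re (wave k1 (of_real x0 - \<i> * of_real \<alpha>) (of_real t0)) = 0"
      using power2_eq_iff[of _ \<i>] by auto
    then show False
      using line(3) by (simp add: wave_on_line)
  qed
  obtain \<delta> where \<delta>: "\<delta> > 0"
    "\<forall>t\<in>{t. \<exists>x. soliton_F s k1 k2 (of_real x - \<i> * of_real \<alpha>) t = 0}. t \<noteq> t0 \<longrightarrow> \<delta> \<le> dist t0 t"
    using finite_set_avoid[OF finite_singular_times] line(3) c2 by (metis less_irrefl)
  show ?thesis
    by (rule that[OF \<delta>(1) _ F0 G0]) (use \<delta>(2) in \<open>force simp: dist_real_def abs_minus_commute\<close>)
qed

end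

section \<open>Blow-up of two-soliton solutions\<close>

theorem mainTheorem1:
  fixes k1 k2 :: real
  assumes "0 < k1" and "k1 < k2"
  shows "(\<forall>s \<in> {1, -1 :: real}. \<exists>\<alpha> t0 \<delta> :: real. \<delta> > 0 \<and>
            (let T = {t. 0 < \<bar>t - t0\<bar> \<and> \<bar>t - t0\<bar> < \<delta>};
                 u = (\<lambda>(x::complex) t. two_soliton s k1 k2 (x - \<i> * of_real \<alpha>) t);
                 v = (\<lambda>(x::real) t. u (of_real x) t)
             in (\<forall>t\<in>T. \<forall>x::real. \<not> is_pole (\<lambda>z. u z t) (of_real x)) \<and>
                smooth_mKdV_solution v T \<and>
                (\<forall>t\<in>T. exp_decay (\<lambda>x. v x t)) \<and>
                (\<exists>x::real. is_pole (\<lambda>z. u z t0) (of_real x))))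
         \<and>
         (\<exists>(v :: real \<Rightarrow> real \<Rightarrow> complex) t1 t0. t1 < t0 \<and>
            smooth_mKdV_solution v {t1<..<t0} \<and>
            (\<forall>t\<in>{t1<..<t0}. exp_decay (\<lambda>x. v x t)) \<and>
            blows_up_at v t0)"
proof (intro conjI ballI)
  fix s :: real
  assume "s \<in> {1, -1}"
  then interpret soliton_pair k1 k2 s
    using assms by unfold_locales
  obtain \<alpha> t0 \<delta> x0 where *: "\<delta> > 0"
    "\<And>t x. 0 < \<bar>t - t0\<bar> \<Longrightarrow> \<bar>t - t0\<bar> < \<delta> \<Longrightarrow> soliton_F s k1 k2 (of_real x - \<i> * of_real \<alpha>) t \<noteq> 0"
    "soliton_F s k1 k2 (of_real x0 - \<i> * of_real \<alpha>) t0 = 0"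
    "soliton_G s k1 k2 (of_real x0 - \<i> * of_real \<alpha>) t0 \<noteq> 0"
    by (rule exists_isolated_crossing) blast
  have T: "open {t. 0 < \<bar>t - t0\<bar> \<and> \<bar>t - t0\<bar> < \<delta>}"
    by (intro open_Collect_conj open_Collect_less continuous_intros)
  show "\<exists>\<alpha> t0 \<delta> :: real. \<delta> > 0 \<and>
            (let T = {t. 0 < \<bar>t - t0\<bar> \<and> \<bar>t - t0\<bar> < \<delta>};
                 u = (\<lambda>(x::complex) t. two_soliton s k1 k2 (x - \<i> * of_real \<alpha>) t);
                 v = (\<lambda>(x::real) t. u (of_real x) t)
             in (\<forall>t\<in>T. \<forall>x::real. \<not> is_pole (\<lambda>z. u z t) (of_real x)) \<and>
                smooth_mKdV_solution v T \<and>
                (\<forall>t\<in>T. exp_decay (\<lambda>x. v x t)) \<and>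
                (\<exists>x::real. is_pole (\<lambda>z. u z t0) (of_real x)))"
    unfolding Let_def
    by (rule exI[of _ \<alpha>], rule exI[of _ t0], rule exI[of _ \<delta>], intro conjI ballI allI exI[of _ x0]
        not_is_pole_two_soliton smooth_mKdV_two_soliton exp_decay_two_soliton is_pole_two_soliton T *)
       auto
next
  interpret soliton_pair k1 k2 1
    using assms by unfold_locales auto
  obtain \<alpha> t0 \<delta> x0 where *: "\<delta> > 0"
    "\<And>t x. 0 < \<bar>t - t0\<bar> \<Longrightarrow> \<bar>t - t0\<bar> < \<delta> \<Longrightarrow> soliton_F 1 k1 k2 (of_real x - \<i> * of_real \<alpha>) t \<noteq> 0"
    "soliton_F 1 k1 k2 (of_real x0 - \<i> * of_real \<alpha>) t0 = 0"
    "soliton_G 1 k1 k2 (of_real x0 - \<i> * of_real \<alpha>) t0 \<noteq> 0"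
    by (rule exists_isolated_crossing) blast
  have nz: "soliton_F 1 k1 k2 (of_real x - \<i> * of_real \<alpha>) t \<noteq> 0" if "t \<in> {t0 - \<delta><..<t0}" for x t
    using that by (intro *) auto
  let ?v = "\<lambda>x t. two_soliton 1 k1 k2 (of_real x - \<i> * of_real \<alpha>) t"
  have "\<forall>\<^sub>F t in at_left t0. t \<in> {t0 - \<delta><..<t0}"
    using *(1) by (intro eventually_at_left_real) simp
  then have "filterlim (\<lambda>t. norm (?v x0 t)) at_top (at_left t0)"
    by (intro two_soliton_norm_at_top *) (erule eventually_mono, rule nz)
  then have "blows_up_at ?v t0"
    unfolding blows_up_at_def filterlim_at_top_dense by (blast intro: eventually_mono)
  then show "\<exists>(v :: real \<Rightarrow> real \<Rightarrow> complex) t1 t0. t1 < t0 \<and>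
            smooth_mKdV_solution v {t1<..<t0} \<and>
            (\<forall>t\<in>{t1<..<t0}. exp_decay (\<lambda>x. v x t)) \<and>
            blows_up_at v t0"
    using *(1) nz
    by (intro exI[of _ ?v] exI[of _ "t0 - \<delta>"] exI[of _ t0] conjI ballI
        smooth_mKdV_two_soliton exp_decay_two_soliton) auto
qed

end
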